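(* Let $A\in\mathbb{R}^{n\times n}$ be an arbitrary symmetric matrix of rank $2$ with all entries non-negative. For $i_1,i_2\in\{1,\dots,n\}$ with $i_1<i_2$, let $\tilde{A}:=A[\{i_1,i_2\}]$. Suppose that $i_1,i_2$ are chosen so that $\tilde A$ is nonsingular and $\|\tilde{A}^{-1}\|_1$ is minimum among all nonsingular $2\times 2$ principal submatrices of $A$. Let $H\in\mathbb{R}^{n\times n}$ be the matrix that is equal to zero, except that its submatrix with row/column indices $\{i_1,i_2\}$ is equal to $\tilde{A}^{-1}$. Then $H$ is a symmetric reflexive generalized inverse of $A$ with minimum 1-norm; that is, $H$ is a symmetric reflexive generalized inverse of $A$, and $\|H\|_1\le\|G\|_1$ for every symmetric reflexive generalized inverse $G$ of $A$.
   Context: All matrices are real. A generalized inverse of $A\in\mathbb{R}^{m\times n}$ is a matrix $H\in\mathbb{R}^{n\times m}$ with $AHA=A$. It is called reflexive if in addition $HAH=H$, and (when $m=n$) symmetric if $H=H^\top$. For a matrix $H$, $\|H\|_1:=\sum_{i,j}|h_{ij}|$ denotes the vector 1-norm of the entries of $H$ (not the induced operator norm). For a symmetric matrix $A$ and an index set $S$, $A[S]$ denotes the principal submatrix of $A$ with row and column indices $S$. *)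

theory Defs
  imports "HOL-Analysis.Analysis"
begin

definition generalized_inverse :: "real ^ 'n ^ 'm \<Rightarrow> real ^ 'm ^ 'n \<Rightarrow> bool" where
  "generalized_inverse A H \<longleftrightarrow> A ** H ** A = A"

definition reflexive_generalized_inverse :: "real ^ 'n ^ 'm \<Rightarrow> real ^ 'm ^ 'n \<Rightarrow> bool" where
  "reflexive_generalized_inverse A H \<longleftrightarrow> generalized_inverse A H \<and> H ** A ** H = H"

definition symmetric_matrix :: "real ^ 'n ^ 'n \<Rightarrow> bool" where
  "symmetric_matrix A \<longleftrightarrow> A = transpose A"

(* The entrywise 1-norm, not the induced operator norm. *)
definition norm1 :: "real ^ 'n ^ 'm \<Rightarrow> real" where
  "norm1 H = (\<Sum>i\<in>UNIV. \<Sum>j\<in>UNIV. \<bar>H $ i $ j\<bar>)"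

(* A[{i1, i2}] for i1 < i2.  The type 2 has exactly the elements 1 and 2 (with 2 = 0),
   so the first row and column come from i1 and the second ones from i2. *)
definition principal_submatrix2 :: "real ^ 'n ^ 'n \<Rightarrow> 'n \<Rightarrow> 'n \<Rightarrow> real ^ 2 ^ 2" where
  "principal_submatrix2 A i1 i2 =
    (\<chi> p q. A $ (if p = 1 then i1 else i2) $ (if q = 1 then i1 else i2))"

end

theory Submission
  imports Defs
begin

text \<open>
  Write \<open>a, b, b, d\<close> for the entries of the chosen submatrix and \<open>D = a d - b\<^sup>2\<close>. Since \<open>A\<close> has
  rank 2, column \<open>k\<close> of \<open>A\<close> is \<open>p\<^sub>k\<close> times column \<open>i1\<close> plus \<open>q\<^sub>k\<close> times column \<open>i2\<close>. Put
  \<open>v = A z\<close> with \<open>z = H (e\<^sub>1 - e\<^sub>2)\<close>, where \<open>e\<^sub>1, e\<^sub>2\<close> are the unit vectors at \<open>i1, i2\<close>; then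
  \<open>v\<^sub>k = p\<^sub>k - q\<^sub>k\<close>. Exchanging one index of the submatrix for \<open>k\<close> multiplies its determinant by
  \<open>q\<^sub>k\<^sup>2\<close> or \<open>p\<^sub>k\<^sup>2\<close>, and the minimality of the 1-norm under these exchanges, together with
  \<open>A \<ge> 0\<close>, gives \<open>\<bar>v\<^sub>k\<bar> \<le> 1\<close>. As the inverse has the sign pattern of \<open>\<plusminus>(e\<^sub>1 - e\<^sub>2)(e\<^sub>1 - e\<^sub>2)\<^sup>T\<close>, every
  generalized inverse \<open>G\<close> satisfies
  \<open>\<parallel>H\<parallel>\<^sub>1 = (a + d + 2 b) / \<bar>D\<bar> = \<bar>z\<^sup>T A z\<bar> = \<bar>v\<^sup>T G v\<bar> \<le> \<parallel>G\<parallel>\<^sub>1\<close>.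
\<close>

lemma sum_supported_on_pair:
  fixes f :: "'n::finite \<Rightarrow> real"
  assumes "i \<noteq> j" and "\<And>l. l \<notin> {i, j} \<Longrightarrow> f l = 0"
  shows "(\<Sum>l\<in>UNIV. f l) = f i + f j"
proof -
  have "(\<Sum>l\<in>UNIV. f l) = (\<Sum>l\<in>{i, j}. f l)"
    by (rule sum.mono_neutral_right) (use assms(2) in auto)
  then show ?thesis
    using assms(1) by simp
qed

lemma matrix_mult_supported_on_pair:
  fixes A :: "real ^ 'n ^ 'm" and B :: "real ^ 'k ^ 'n"
  assumes "i \<noteq> j" and "\<And>l. l \<notin> {i, j} \<Longrightarrow> A $ r $ l * B $ l $ c = 0"
  shows "(A ** B) $ r $ c = A $ r $ i * B $ i $ c + A $ r $ j * B $ j $ c"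
  unfolding matrix_matrix_mult_def vec_lambda_beta
  by (rule sum_supported_on_pair[OF assms])

text \<open>\<open>matrix_inv\<close> is a choice among two-sided inverses, and for square matrices
  a right inverse is also a left one.\<close>

lemma matrix_inv_unique:
  fixes A B :: "real ^ 'n ^ 'n"
  assumes "A ** B = mat 1"
  shows "matrix_inv A = B"
proof -
  have BA: "B ** A = mat 1"
    using assms by (simp add: matrix_left_right_inverse)
  have "A ** matrix_inv A = mat 1 \<and> matrix_inv A ** A = mat 1"
    unfolding matrix_inv_def by (rule someI[of _ B]) (simp add: assms BA)
  then have "B ** (A ** matrix_inv A) = B"
    by simp
  then show ?thesis
    by (simp add: matrix_mul_assoc BA)
qed

lemma invertible_2x2_iff:
  fixes M :: "real ^ 2 ^ 2"
  shows "invertible M \<longleftrightarrow> M $ 1 $ 1 * M $ 2 $ 2 - M $ 1 $ 2 * M $ 2 $ 1 \<noteq> 0"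
  by (simp add: invertible_det_nz det_2)

lemma matrix_inv_2x2:
  fixes M :: "real ^ 2 ^ 2"
  defines "D \<equiv> M $ 1 $ 1 * M $ 2 $ 2 - M $ 1 $ 2 * M $ 2 $ 1"
  assumes "invertible M"
  shows "matrix_inv M $ 1 $ 1 = M $ 2 $ 2 / D"
    and "matrix_inv M $ 1 $ 2 = - M $ 1 $ 2 / D"
    and "matrix_inv M $ 2 $ 1 = - M $ 2 $ 1 / D"
    and "matrix_inv M $ 2 $ 2 = M $ 1 $ 1 / D"
proof -
  define N :: "real ^ 2 ^ 2" where
    "N = (\<chi> i j. if i = 1 then (if j = 1 then M $ 2 $ 2 / D else - M $ 1 $ 2 / D)
                 else (if j = 1 then - M $ 2 $ 1 / D else M $ 1 $ 1 / D))"
  have "D \<noteq> 0"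
    using assms(2) by (simp add: invertible_2x2_iff D_def)
  then have "M ** N = mat 1"
    by (simp add: vec_eq_iff forall_2 matrix_matrix_mult_def sum_2 mat_def N_def
        diff_divide_distrib[symmetric] mult.commute D_def)
  then have "matrix_inv M = N"
    by (rule matrix_inv_unique)
  then show "matrix_inv M $ 1 $ 1 = M $ 2 $ 2 / D"
    and "matrix_inv M $ 1 $ 2 = - M $ 1 $ 2 / D"
    and "matrix_inv M $ 2 $ 1 = - M $ 2 $ 1 / D"
    and "matrix_inv M $ 2 $ 2 = M $ 1 $ 1 / D"
    by (simp_all add: N_def)
qed

text \<open>The adjugate only permutes the four entries up to sign, so inverting divides the 1-norm
  by the absolute determinant.\<close>

lemma norm1_matrix_inv_2x2:
  fixes M :: "real ^ 2 ^ 2"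
  assumes "invertible M"
  shows "norm1 (matrix_inv M) =
    (\<bar>M $ 1 $ 1\<bar> + \<bar>M $ 1 $ 2\<bar> + \<bar>M $ 2 $ 1\<bar> + \<bar>M $ 2 $ 2\<bar>)
      / \<bar>M $ 1 $ 1 * M $ 2 $ 2 - M $ 1 $ 2 * M $ 2 $ 1\<bar>"
  by (simp add: norm1_def sum_2 matrix_inv_2x2[OF assms] add_divide_distrib)

text \<open>The nonzero minor makes columns \<open>i\<close> and \<open>j\<close> independent, and
  two independent vectors span a column space of dimension 2.\<close>

lemma column_combination_of_rank_2:
  fixes A :: "real ^ 'n ^ 'm"
  assumes "rank A = 2" and "A $ r $ i * A $ s $ j - A $ r $ j * A $ s $ i \<noteq> 0"
  obtains p q where "\<And>l. A $ l $ k = p * A $ l $ i + q * A $ l $ j"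
proof -
  let ?x = "column i A" and ?y = "column j A"
  have neq: "?x \<noteq> ?y"
  proof
    assume "?x = ?y"
    then have "\<And>l. A $ l $ i = A $ l $ j"
      by (simp add: column_def vec_eq_iff)
    with assms(2) show False
      by simp
  qed
  have nz: "?y \<noteq> 0"
  proof
    assume "?y = 0"
    then have "\<And>l. A $ l $ j = 0"
      by (simp add: column_def vec_eq_iff)
    with assms(2) show False
      by simp
  qed
  have "?x \<notin> span {?y}"
  proof
    assume "?x \<in> span {?y}"
    then obtain c where "?x = c *\<^sub>R ?y"
      by (auto simp: span_singleton)
    then have "\<And>l. A $ l $ i = c * A $ l $ j"
      by (simp add: column_def vec_eq_iff)
    with assms(2) show False
      by simp
  qed
  then have "independent {?x, ?y}"
    using neq nz by (simp add: independent_insert)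
  then have "columns A \<subseteq> span {?x, ?y}"
    by (intro card_ge_dim_independent)
      (use assms(1) neq in \<open>auto simp: columns_def column_rank_def\<close>)
  then have "column k A \<in> span {?x, ?y}"
    by (auto simp: columns_def)
  then obtain p where "column k A - p *\<^sub>R ?x \<in> span {?y}"
    by (auto simp: span_breakdown_eq)
  then obtain q where "column k A - p *\<^sub>R ?x = q *\<^sub>R ?y"
    by (auto simp: span_singleton)
  then have "column k A = p *\<^sub>R ?x + q *\<^sub>R ?y"
    by (simp add: algebra_simps)
  then have "\<And>l. A $ l $ k = p * A $ l $ i + q * A $ l $ j"
    by (simp add: column_def vec_eq_iff)
  then show thesis
    by (rule that)
qed

text \<open>Here \<open>p\<close>, \<open>q\<close> are the coefficients of a column
  \<open>k\<close>. The assumptions \<open>nonneg\<close> concern the entries of that column in rows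
  \<open>i1\<close>, \<open>i2\<close>; \<open>exchange\<close> is minimality against the pair
  \<open>{i1, k}\<close>, cleared of denominators.\<close>

lemma exchange_bound:
  fixes a b d p q :: real
  assumes "a \<ge> 0" "b \<ge> 0" "d \<ge> 0" and "a * d - b * b \<noteq> 0"
    and nonneg: "p * a + q * b \<ge> 0" "p * b + q * d \<ge> 0"
    and exchange: "q\<^sup>2 * (a + d + 2 * b)
      \<le> a + 2 * (p * a + q * b) + (p\<^sup>2 * a + 2 * p * q * b + q\<^sup>2 * d)"
  shows "q - p \<le> 1"
proof (rule ccontr)
  assume "\<not> q - p \<le> 1"
  then have neg: "1 + p - q < 0"
    by simp
  \<comment> \<open>The terms in \<open>d\<close> cancel, and right minus left side of
    \<open>exchange\<close> factors.\<close>
  have "(1 + p - q) * (a * (1 + p + q) + 2 * b * q) \<ge> 0"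
    using exchange by (simp add: algebra_simps power2_eq_square)
  then have le: "a * (1 + p + q) + 2 * b * q \<le> 0"
    using neg by (simp add: zero_le_mult_iff)
  show False
  proof (cases "q > 0")
    case True
    \<comment> \<open>The second factor splits into four nonnegative terms, so all vanish; then
      \<open>a = b = 0\<close>, against the nonzero determinant.\<close>
    have "a + (p * a + q * b) + q * a + q * b \<le> 0"
      using le by (simp add: algebra_simps)
    moreover have "q * a \<ge> 0" "q * b \<ge> 0"
      using True assms by simp_all
    ultimately have "a = 0" "q * b = 0"
      using assms(1) nonneg(1) by linarith+
    then show False
      using True assms(4) by simp
  next
    case False
    \<comment> \<open>Now both nonnegative column entries are sums of nonpositive terms, which again
      forces \<open>a = b = 0\<close>.\<close>
    then have "q \<le> 0" "p < 0"
      using neg by linarith+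
    then have "p * a \<le> 0" "q * b \<le> 0" "p * b \<le> 0" "q * d \<le> 0"
      using assms by (simp_all add: mult_nonpos_nonneg)
    then have "p * a = 0" "p * b = 0"
      using nonneg by linarith+
    then show False
      using \<open>p < 0\<close> assms(4) by simp
  qed
qed

text \<open>With \<open>v = A z\<close>, the identity \<open>A G A = A\<close> and symmetry of
  \<open>A\<close> turn the form into the sum of \<open>v i * G i j * v j\<close>, whose weights
  \<open>v i * v j\<close> are at most 1 in absolute value.\<close>

lemma generalized_inverse_quadratic_form_le_norm1:
  fixes A G :: "real ^ 'n ^ 'n" and z :: "real ^ 'n"
  assumes "symmetric_matrix A" and "generalized_inverse A G"
    and "\<And>k. \<bar>(A *v z) $ k\<bar> \<le> 1"
  shows "\<bar>z \<bullet> (A *v z)\<bar> \<le> norm1 G"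
proof -
  let ?v = "A *v z"
  have "A *v (G *v ?v) = ?v"
    using assms(2) by (simp add: generalized_inverse_def matrix_vector_mul_assoc matrix_mul_assoc)
  then have "z \<bullet> ?v = (z v* A) \<bullet> (G *v ?v)"
    by (simp add: dot_lmul_matrix)
  also have "z v* A = ?v"
    using assms(1) unfolding symmetric_matrix_def by (metis vector_transpose_matrix)
  finally have "z \<bullet> ?v = (\<Sum>i\<in>UNIV. \<Sum>j\<in>UNIV. ?v $ i * (G $ i $ j * ?v $ j))"
    by (simp add: inner_vec_def matrix_vector_mult_def[of G] sum_distrib_left)
  also have "\<bar>\<dots>\<bar> \<le> (\<Sum>i\<in>UNIV. \<bar>\<Sum>j\<in>UNIV. ?v $ i * (G $ i $ j * ?v $ j)\<bar>)"
    by (rule sum_abs)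
  also have "\<dots> \<le> (\<Sum>i\<in>UNIV. \<Sum>j\<in>UNIV. \<bar>?v $ i * (G $ i $ j * ?v $ j)\<bar>)"
    by (intro sum_mono sum_abs)
  also have "\<dots> \<le> norm1 G"
    unfolding norm1_def
  proof (intro sum_mono)
    fix i j
    have "\<bar>?v $ i\<bar> * \<bar>?v $ j\<bar> \<le> 1"
      using assms(3) by (intro mult_le_one) auto
    then have "\<bar>G $ i $ j\<bar> * (\<bar>?v $ i\<bar> * \<bar>?v $ j\<bar>) \<le> \<bar>G $ i $ j\<bar>"
      by (simp add: mult_left_le)
    then show "\<bar>?v $ i * (G $ i $ j * ?v $ j)\<bar> \<le> \<bar>G $ i $ j\<bar>"
      by (simp add: abs_mult mult_ac)
  qed
  finally show ?thesis .
qed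

theorem theorem4:
  fixes A H :: "real ^ 'n::{finite, linorder} ^ 'n::{finite, linorder}"
    and i1 i2 :: "'n::{finite, linorder}"
  assumes "symmetric_matrix A"
    and "rank A = 2"
    and "\<And>i j. A $ i $ j \<ge> 0"
    and "i1 < i2"
    and "invertible (principal_submatrix2 A i1 i2)"
    and "\<And>j1 j2. j1 < j2 \<Longrightarrow> invertible (principal_submatrix2 A j1 j2) \<Longrightarrow>
           norm1 (matrix_inv (principal_submatrix2 A i1 i2))
             \<le> norm1 (matrix_inv (principal_submatrix2 A j1 j2))"
    and "principal_submatrix2 H i1 i2 = matrix_inv (principal_submatrix2 A i1 i2)"
    and "\<And>i j. i \<notin> {i1, i2} \<or> j \<notin> {i1, i2} \<Longrightarrow> H $ i $ j = 0"
  shows "symmetric_matrix H \<and> reflexive_generalized_inverse A H \<and>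
    (\<forall>G. symmetric_matrix G \<and> reflexive_generalized_inverse A G \<longrightarrow> norm1 H \<le> norm1 G)"
proof -

  \<comment> \<open>Entries of the chosen block and of \<open>H\<close>, and column
    coefficients\<close>
  define a b d D where "a = A $ i1 $ i1" and "b = A $ i1 $ i2" and "d = A $ i2 $ i2"
    and "D = a * d - b * b"
  have neq: "i1 \<noteq> i2"
    using assms(4) by simp
  have sym: "A $ i $ j = A $ j $ i" for i j
    using assms(1) unfolding symmetric_matrix_def by (metis transpose_def vec_lambda_beta)
  have nonneg: "a \<ge> 0" "b \<ge> 0" "d \<ge> 0"
    by (simp_all add: a_def b_def d_def assms(3))
  have A_entries: "A $ i1 $ i1 = a" "A $ i1 $ i2 = b" "A $ i2 $ i1 = b" "A $ i2 $ i2 = d"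
    using sym by (simp_all add: a_def b_def d_def)
  have sub: "principal_submatrix2 M i j $ 1 $ 1 = M $ i $ i"
    "principal_submatrix2 M i j $ 1 $ 2 = M $ i $ j"
    "principal_submatrix2 M i j $ 2 $ 1 = M $ j $ i"
    "principal_submatrix2 M i j $ 2 $ 2 = M $ j $ j" for M :: "real ^ 'n::{finite, linorder} ^ 'n::{finite, linorder}" and i j
    by (simp_all add: principal_submatrix2_def)
  have D: "D \<noteq> 0"
    using assms(5) by (simp add: invertible_2x2_iff sub A_entries D_def)
  have H_entries: "H $ i1 $ i1 = d / D" "H $ i1 $ i2 = - b / D" "H $ i2 $ i1 = - b / D"
    "H $ i2 $ i2 = a / D"
    using matrix_inv_2x2[OF assms(5)]
    by (simp_all add: assms(7)[symmetric] sub A_entries D_def)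
  have H_zero: "H $ i $ j = 0" if "i \<notin> {i1, i2} \<or> j \<notin> {i1, i2}" for i j
    using assms(8) that .
  have "H $ i $ j = H $ j $ i" for i j
  proof (cases "i \<in> {i1, i2} \<and> j \<in> {i1, i2}")
    case True
    then show ?thesis
      by (auto simp: H_entries)
  next
    case False
    then show ?thesis
      using H_zero by metis
  qed
  then have H_sym: "symmetric_matrix H"
    by (simp add: symmetric_matrix_def transpose_def vec_eq_iff)
  have "\<exists>p q. \<forall>l. A $ l $ k = p * A $ l $ i1 + q * A $ l $ i2" for k
    by (rule column_combination_of_rank_2[OF assms(2), of i1 i1 i2 i2 k])
      (use D in \<open>auto simp: A_entries D_def\<close>)
  then obtain p q where col: "\<And>l k. A $ l $ k = p k * A $ l $ i1 + q k * A $ l $ i2"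
    by metis
  have row: "A $ i1 $ k = p k * a + q k * b" "A $ i2 $ k = p k * b + q k * d" for k
    using col[of i1 k] col[of i2 k] by (simp_all only: A_entries)
  \<comment> \<open>By symmetry, the diagonal entry is the quadratic form of the block at
    \<open>(p k, q k)\<close>.\<close>
  have diag: "A $ k $ k = (p k)\<^sup>2 * a + 2 * p k * q k * b + (q k)\<^sup>2 * d" for k
    using col[of k k] sym[of k i1] sym[of k i2] row[of k]
    by (simp add: algebra_simps power2_eq_square)

  \<comment> \<open>Generalized inverse and reflexivity\<close>
  have AH: "(A ** H) $ l $ k = A $ l $ i1 * H $ i1 $ k + A $ l $ i2 * H $ i2 $ k" for l k
    using H_zero by (intro matrix_mult_supported_on_pair[OF neq]) auto
  have AHM: "(A ** H ** M) $ l $ k = (A ** H) $ l $ i1 * M $ i1 $ k + (A ** H) $ l $ i2 * M $ i2 $ k"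
    for M :: "real ^ 'n::{finite, linorder} ^ 'n::{finite, linorder}" and l k
  proof -
    have "(A ** H) $ l $ j = 0" if "j \<notin> {i1, i2}" for j
      using H_zero that by (simp add: AH)
    then show ?thesis
      by (intro matrix_mult_supported_on_pair[OF neq]) auto
  qed
  have AHA: "A ** H ** A = A"
  proof -
    have "(A ** H ** A) $ l $ k = A $ l $ k" for l k
    proof -
      \<comment> \<open>Scaling by \<open>D\<close> replaces the block of \<open>H\<close> by the
        adjugate of the block of \<open>A\<close>.\<close>
      have "D * (A ** H ** A) $ l $ k
          = (A $ l $ i1 * d - A $ l $ i2 * b) * (p k * a + q k * b)
            + (A $ l $ i2 * a - A $ l $ i1 * b) * (p k * b + q k * d)"
        using D unfolding AHM AH H_entries row by (simp add: field_simps)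
      also have "\<dots> = D * (p k * A $ l $ i1 + q k * A $ l $ i2)"
        by (simp add: D_def algebra_simps)
      finally show ?thesis
        using D col[of l k] by simp
    qed
    then show ?thesis
      by (simp add: vec_eq_iff)
  qed
  have HAH: "H ** A ** H = H"
  proof -
    \<comment> \<open>On the pair, \<open>A ** H\<close> is the block times its inverse.\<close>
    have unit: "(A ** H) $ i1 $ i1 = 1" "(A ** H) $ i1 $ i2 = 0"
      "(A ** H) $ i2 $ i1 = 0" "(A ** H) $ i2 $ i2 = 1"
      using D by (simp_all add: AH A_entries H_entries diff_divide_distrib[symmetric])
        (simp_all add: D_def mult.commute)
    have "(H ** (A ** H)) $ l $ k = H $ l $ k" for l k
    proof -
      have "(H ** (A ** H)) $ l $ k = H $ l $ i1 * (A ** H) $ i1 $ k + H $ l $ i2 * (A ** H) $ i2 $ k"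
        using H_zero by (intro matrix_mult_supported_on_pair[OF neq]) auto
      also have "\<dots> = H $ l $ k"
      proof (cases "k \<in> {i1, i2}")
        case True
        then show ?thesis
          by (auto simp: unit)
      next
        case False
        then show ?thesis
          by (simp add: AH H_zero)
      qed
      finally show ?thesis .
    qed
    then show ?thesis
      by (simp add: vec_eq_iff matrix_mul_assoc)
  qed

  \<comment> \<open>Minimality under exchange of one index\<close>
  have norm_sub: "norm1 (matrix_inv (principal_submatrix2 A i j))
      = (A $ i $ i + 2 * A $ i $ j + A $ j $ j) / \<bar>A $ i $ i * A $ j $ j - A $ i $ j * A $ i $ j\<bar>"
    if "invertible (principal_submatrix2 A i j)" for i j
    using norm1_matrix_inv_2x2[OF that] sym[of j i] by (simp add: sub assms(3))
  have minimal: "(a + d + 2 * b) / \<bar>D\<bar>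
      \<le> (A $ i $ i + 2 * A $ i $ j + A $ j $ j) / \<bar>A $ i $ i * A $ j $ j - A $ i $ j * A $ i $ j\<bar>"
    if det: "A $ i $ i * A $ j $ j - A $ i $ j * A $ i $ j \<noteq> 0" for i j
  proof -
    have ordered: "(a + d + 2 * b) / \<bar>D\<bar>
      \<le> (A $ i $ i + 2 * A $ i $ j + A $ j $ j) / \<bar>A $ i $ i * A $ j $ j - A $ i $ j * A $ i $ j\<bar>"
      if "i < j" and "A $ i $ i * A $ j $ j - A $ i $ j * A $ i $ j \<noteq> 0" for i j
    proof -
      have inv: "invertible (principal_submatrix2 A i j)"
        using that(2) sym[of j i] by (simp add: invertible_2x2_iff sub)
      show ?thesis
        using assms(6)[OF that(1) inv] norm_sub[OF assms(5)] norm_sub[OF inv]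
        by (simp add: A_entries D_def add_ac)
    qed
    \<comment> \<open>Equal indices give determinant zero, and both sides are symmetric in
      \<open>i\<close> and \<open>j\<close>, so the ordered case suffices.\<close>
    have "i \<noteq> j"
      using det by auto
    then consider "i < j" | "j < i"
      by (meson linorder_neqE)
    then show ?thesis
    proof cases
      case 1
      then show ?thesis
        using ordered det by blast
    next
      case 2
      then show ?thesis
        using ordered[of j i] det by (simp add: sym[of j i] mult.commute add_ac)
    qed
  qed
  have exchange: "t\<^sup>2 * (a + d + 2 * b) \<le> A $ i $ i + 2 * A $ i $ j + A $ j $ j"
    if det: "A $ i $ i * A $ j $ j - A $ i $ j * A $ i $ j = t\<^sup>2 * D" for i j t
  \<comment> \<open>For \<open>t = 0\<close> the new pair is singular and minimality is silent, but
    the left side is zero. Below, \<open>t\<close> is the coefficient of the index being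
    replaced.\<close>
  proof (cases "t = 0")
    case True
    then show ?thesis
      using assms(3)[of i i] assms(3)[of i j] assms(3)[of j j] by simp
  next
    case False
    then have "(a + d + 2 * b) / \<bar>D\<bar> \<le> (A $ i $ i + 2 * A $ i $ j + A $ j $ j) / \<bar>t\<^sup>2 * D\<bar>"
      using minimal[of i j] D unfolding det by simp
    then have "a + d + 2 * b \<le> (A $ i $ i + 2 * A $ i $ j + A $ j $ j) / t\<^sup>2"
      using D by (simp add: abs_mult divide_divide_eq_left[symmetric] divide_le_cancel
          del: divide_divide_eq_left)
    then show ?thesis
      using False by (simp add: pos_le_divide_eq mult.commute)
  qed
  have diff_le: "q k - p k \<le> 1" "p k - q k \<le> 1" for k
  proof -
    have row_nonneg: "p k * a + q k * b \<ge> 0" "p k * b + q k * d \<ge> 0"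
      using assms(3)[of i1 k] assms(3)[of i2 k] by (simp_all add: row)
    have "(q k)\<^sup>2 * (a + d + 2 * b) \<le> A $ i1 $ i1 + 2 * A $ i1 $ k + A $ k $ k"
      by (rule exchange)
        (unfold A_entries row[of k] diag[of k], simp add: D_def algebra_simps power2_eq_square)
    then show "q k - p k \<le> 1"
      using nonneg D row_nonneg
      unfolding A_entries row[of k] diag[of k]
      by (intro exchange_bound[of a b d]) (simp_all add: D_def)
    \<comment> \<open>Replacing \<open>i1\<close> instead of \<open>i2\<close> swaps
      \<open>a\<close> with \<open>d\<close> and \<open>p\<close> with \<open>q\<close>.\<close>
    have "(p k)\<^sup>2 * (a + d + 2 * b) \<le> A $ i2 $ i2 + 2 * A $ i2 $ k + A $ k $ k"
      by (rule exchange)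
        (unfold A_entries row[of k] diag[of k], simp add: D_def algebra_simps power2_eq_square)
    then show "p k - q k \<le> 1"
      using nonneg D row_nonneg
      unfolding A_entries row[of k] diag[of k]
      by (intro exchange_bound[of d b a]) (simp_all add: D_def algebra_simps)
  qed

  \<comment> \<open>The test vector and the comparison of norms\<close>
  define z :: "real ^ 'n::{finite, linorder}" where "z = (\<chi> i. H $ i $ i1 - H $ i $ i2)"
  have z: "z $ i1 = (d + b) / D" "z $ i2 = - (a + b) / D" "\<And>i. i \<notin> {i1, i2} \<Longrightarrow> z $ i = 0"
    by (simp_all add: z_def H_entries H_zero diff_divide_distrib add_divide_distrib)
  have Az_sum: "(A *v z) $ k = A $ k $ i1 * z $ i1 + A $ k $ i2 * z $ i2" for k
    unfolding matrix_vector_mult_def vec_lambda_beta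
    by (rule sum_supported_on_pair[OF neq]) (simp add: z(3))
  have Az: "(A *v z) $ k = p k - q k" for k
  proof -
    have "D * (A *v z) $ k = (p k * a + q k * b) * (d + b) - (p k * b + q k * d) * (a + b)"
      using D sym[of k i1] sym[of k i2] by (simp add: Az_sum row z field_simps)
    also have "\<dots> = D * (p k - q k)"
      by (simp add: D_def algebra_simps)
    finally show ?thesis
      using D by simp
  qed
  have "z \<bullet> (A *v z) = z $ i1 * (A *v z) $ i1 + z $ i2 * (A *v z) $ i2"
    unfolding inner_vec_def inner_real_def by (rule sum_supported_on_pair[OF neq]) (simp add: z(3))
  moreover have "(A *v z) $ i1 = 1" "(A *v z) $ i2 = - 1"
  proof -
    have "D * (A *v z) $ i1 = D * 1" "D * (A *v z) $ i2 = D * (- 1)"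
      using D by (simp_all add: Az_sum A_entries z field_simps) (simp_all add: D_def algebra_simps)
    then show "(A *v z) $ i1 = 1" "(A *v z) $ i2 = - 1"
      using D by (metis mult_left_cancel)+
  qed
  ultimately have "z \<bullet> (A *v z) = (a + d + 2 * b) / D"
    by (simp add: z add_divide_distrib diff_divide_distrib)
  then have zAz: "\<bar>z \<bullet> (A *v z)\<bar> = (a + d + 2 * b) / \<bar>D\<bar>"
    using nonneg by simp
  have "norm1 H = (\<Sum>j\<in>UNIV. \<bar>H $ i1 $ j\<bar>) + (\<Sum>j\<in>UNIV. \<bar>H $ i2 $ j\<bar>)"
    unfolding norm1_def using neq H_zero by (intro sum_supported_on_pair) simp_all
  also have "\<dots> = (\<bar>H $ i1 $ i1\<bar> + \<bar>H $ i1 $ i2\<bar>) + (\<bar>H $ i2 $ i1\<bar> + \<bar>H $ i2 $ i2\<bar>)"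
    using neq H_zero by (intro arg_cong2[where f = "(+)"] sum_supported_on_pair) simp_all
  \<comment> \<open>The diagonal of the block of \<open>H\<close> has the sign of \<open>D\<close>
    or is zero, the off-diagonal entries the opposite sign or zero; taking the difference of the two
    columns as \<open>z\<close> makes these contributions add up in the quadratic form.\<close>
  also have "\<dots> = (a + d + 2 * b) / \<bar>D\<bar>"
    using nonneg by (simp add: H_entries add_divide_distrib)
  finally have norm_H: "norm1 H = \<bar>z \<bullet> (A *v z)\<bar>"
    by (simp add: zAz)
  have "norm1 H \<le> norm1 G" if "reflexive_generalized_inverse A G" for G
    unfolding norm_H
  proof (rule generalized_inverse_quadratic_form_le_norm1[OF assms(1)])
    show "generalized_inverse A G"
      using that by (simp add: reflexive_generalized_inverse_def)
    show "\<bar>(A *v z) $ k\<bar> \<le> 1" for k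
      using diff_le[of k] by (simp add: Az abs_le_iff)
  qed
  then show ?thesis
    using H_sym AHA HAH by (simp add: reflexive_generalized_inverse_def generalized_inverse_def)
qed

end
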